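(* Let $\ell \ge 2$ be an integer and let $f$ be an eigenform in the Kohnen plus subspace of cusp forms of weight $k=\ell+\tfrac12$ on $\Gamma_0(4)$. Write $$f(z)=\sum_{n=1}^{\infty} a_f(n)\, n^{\frac{k-1}{2}} q^n,\qquad q=e^{2\pi i z},$$ and assume: (1) $a_f(n)$ is real for all $n\ge 1$; (2) the Ramanujan conjecture holds for $f$, that is, for every $\epsilon>0$ and all $n\ge 1$ one has $a_f(n)\ll_{\epsilon} n^{\epsilon}$. Then there is an integer $r\ge 1$ such that the sequence $a_f(n)$ changes sign infinitely often as $n$ ranges over the set $\mathcal P_r$ of positive integers having at most $r$ prime factors. More precisely, the number of sign changes of $a_f(n)$ with $n\in\mathcal P_r$ and $n\le x$ is $\gg \log x$ (for $x$ sufficiently large).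
   Context: The Kohnen plus subspace of weight $k=\ell+\frac12$ on $\Gamma_0(4)$ is the space of half-integral weight cusp forms (in Shimura's sense) of weight $k$ on $\Gamma_0(4)$ whose $n$-th Fourier coefficient vanishes unless $(-1)^\ell n\equiv 0,1 \pmod 4$. An eigenform is a nonzero form in this space that is a common eigenfunction of the Hecke operators $T(p^2)$ for all primes $p$ (for $p=2$, Kohnen's operator on the plus space). $\mathcal P_r$ denotes the set of positive integers $n$ with $\omega(n)\le r$, where $\omega(n)$ is the number of distinct prime factors of $n$. The number of sign changes of $a_f(n)$ with $n\in\mathcal P_r$, $n\le x$, is the number of pairs $n_1<n_2\le x$ in $\mathcal P_r$ such that $a_f(n_1)a_f(n_2)<0$ and $a_f(n)=0$ for all $n\in\mathcal P_r$ with $n_1<n<n_2$. *)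

theory Defs
  imports
    "HOL-Complex_Analysis.Complex_Analysis"
    "HOL-Number_Theory.Number_Theory"
    "HOL-Library.Landau_Symbols"
begin

definition upper_half_plane :: "complex set" where
  "upper_half_plane = {z. Im z > 0}"

definition theta :: "complex \<Rightarrow> complex" where
  "theta z = (\<Sum>\<^sub>\<infinity>m::int. exp (2 * of_real pi * \<i> * of_int (m\<^sup>2) * z))"

definition moebius :: "int \<Rightarrow> int \<Rightarrow> int \<Rightarrow> int \<Rightarrow> complex \<Rightarrow> complex" where
  "moebius a b c d z = (of_int a * z + of_int b) / (of_int c * z + of_int d)"

text \<open>
  Shimura's automorphy factor \<open>j(\<gamma>, z) = \<theta>(\<gamma> z) / \<theta>(z)\<close> for \<open>\<gamma>\<close> in \<open>\<Gamma>\<^sub>0(4)\<close>, which equals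
  \<open>\<epsilon>\<^sub>d\<^sup>-\<^sup>1 (c/d) (c z + d)\<^sup>1\<^sup>/\<^sup>2\<close>. A form of weight \<open>k = l + 1/2\<close> transforms under \<open>j\<^sup>2\<^sup>k\<close>.
\<close>

definition theta_factor :: "int \<Rightarrow> int \<Rightarrow> int \<Rightarrow> int \<Rightarrow> complex \<Rightarrow> complex" where
  "theta_factor a b c d z = theta (moebius a b c d z) / theta z"

text \<open>
  The last clause is vanishing at every cusp: for each \<open>\<gamma>\<close> in \<open>SL\<^sub>2(\<int>)\<close>, the function
  \<open>(c z + d)\<^sup>-\<^sup>k f(\<gamma> z)\<close> tends to 0 as \<open>Im z\<close> tends to infinity. The choice of the branch of
  \<open>(c z + d)\<^sup>k\<close> changes this function only by a factor of modulus 1, hence is immaterial.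
\<close>

definition half_integral_cusp_form :: "nat \<Rightarrow> (complex \<Rightarrow> complex) \<Rightarrow> bool" where
  "half_integral_cusp_form l f \<longleftrightarrow>
     f holomorphic_on upper_half_plane \<and>
     (\<forall>a b c d z. a * d - b * c = 1 \<and> 4 dvd c \<and> z \<in> upper_half_plane \<longrightarrow>
        f (moebius a b c d z) = theta_factor a b c d z ^ (2 * l + 1) * f z) \<and>
     (\<forall>a b c d. a * d - b * c = 1 \<longrightarrow>
        ((\<lambda>z. (of_int c * z + of_int d) powr (- of_real (real l + 1 / 2)) * f (moebius a b c d z))
           \<longlongrightarrow> 0) (filtercomap Im at_top))"

text \<open>
  The \<open>n\<close>-th Fourier coefficient, with the integral taken along the segment from \<open>\<i>\<close> to \<open>\<i> + 1\<close>.
\<close>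

definition fourier_coeff :: "(complex \<Rightarrow> complex) \<Rightarrow> nat \<Rightarrow> complex" where
  "fourier_coeff f n =
     integral {0..1} (\<lambda>x::real. f (of_real x + \<i>) *
       exp (- (2 * of_real pi * \<i> * of_nat n * (of_real x + \<i>))))"

definition plus_index :: "nat \<Rightarrow> nat \<Rightarrow> bool" where
  "plus_index l n \<longleftrightarrow> ((-1) ^ l * int n) mod 4 \<in> {0, 1}"

definition kohnen_plus_cusp_form :: "nat \<Rightarrow> (complex \<Rightarrow> complex) \<Rightarrow> bool" where
  "kohnen_plus_cusp_form l f \<longleftrightarrow>
     half_integral_cusp_form l f \<and> (\<forall>n. \<not> plus_index l n \<longrightarrow> fourier_coeff f n = 0)"

definition kronecker_prime :: "int \<Rightarrow> nat \<Rightarrow> int" where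
  "kronecker_prime a p =
     (if p = 2 then (if even a then 0 else if a mod 8 \<in> {1, 7} then 1 else -1)
      else Legendre a (int p))"

text \<open>
  The action of \<open>T(p\<^sup>2)\<close> on Fourier coefficients. For odd \<open>p\<close> and \<open>f\<close> in the plus space the
  restriction to \<open>plus_index\<close> is automatic, and this is Shimura's operator; for \<open>p = 2\<close>
  the restriction is part of Kohnen's definition.
\<close>

definition hecke_coeff :: "nat \<Rightarrow> nat \<Rightarrow> (nat \<Rightarrow> complex) \<Rightarrow> nat \<Rightarrow> complex" where
  "hecke_coeff l p b n =
     (if plus_index l n then
        b (p\<^sup>2 * n)
        + of_int (kronecker_prime ((-1) ^ l * int n) p) * of_nat p ^ (l - 1) * b n
        + of_nat p ^ (2 * l - 1) * (if p\<^sup>2 dvd n then b (n div p\<^sup>2) else 0)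
      else 0)"

definition hecke :: "nat \<Rightarrow> nat \<Rightarrow> (complex \<Rightarrow> complex) \<Rightarrow> complex \<Rightarrow> complex" where
  "hecke l p f z =
     (\<Sum>n. hecke_coeff l p (fourier_coeff f) n * exp (2 * of_real pi * \<i> * of_nat n * z))"

definition kohnen_plus_eigenform :: "nat \<Rightarrow> (complex \<Rightarrow> complex) \<Rightarrow> bool" where
  "kohnen_plus_eigenform l f \<longleftrightarrow>
     kohnen_plus_cusp_form l f \<and>
     (\<exists>z\<in>upper_half_plane. f z \<noteq> 0) \<and>
     (\<forall>p. prime p \<longrightarrow> (\<exists>ev. \<forall>z\<in>upper_half_plane. hecke l p f z = ev * f z))"

definition almost_primes :: "nat \<Rightarrow> nat set" where
  "almost_primes r = {n. n > 0 \<and> card (prime_factors n) \<le> r}"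

definition sign_changes :: "nat set \<Rightarrow> (nat \<Rightarrow> real) \<Rightarrow> (nat \<times> nat) set" where
  "sign_changes A a =
     {(m, n). m \<in> A \<and> n \<in> A \<and> m < n \<and> a m * a n < 0 \<and> (\<forall>i\<in>A. m < i \<and> i < n \<longrightarrow> a i = 0)}"

definition sign_change_count :: "nat set \<Rightarrow> (nat \<Rightarrow> real) \<Rightarrow> real \<Rightarrow> nat" where
  "sign_change_count A a x = card {(m, n) \<in> sign_changes A a. real n \<le> x}"

end

theory Submission
  imports Defs
begin

text \<open>
  The proof works with \<open>T(4)\<close> alone. Along a chain \<open>t 4\<^sup>\<nu>\<close> the normalised coefficients \<open>u\<^sub>\<nu>\<close> satisfy
  \<open>u\<^sub>\<nu>\<^sub>+\<^sub>2 = \<mu> u\<^sub>\<nu>\<^sub>+\<^sub>1 - u\<^sub>\<nu>\<close> with \<open>\<mu>\<close> independent of \<open>t\<close>, and all members of the chain have at most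
  \<open>\<omega>(t) + 1\<close> prime factors. If \<open>\<mu> < 2\<close>, every window of bounded length in a chain contains both
  signs. If \<open>\<mu> \<ge> 2\<close>, the sign is constant along each chain, but there are chains of either sign:
  otherwise, by the plus condition, \<open>f(1/4 + i y)\<close> could not tend to 0 as \<open>y \<rightarrow> 0\<close>, although
  \<open>1/4\<close> is a cusp equivalent to infinity. In both cases each interval \<open>[4\<^sup>\<nu>, D 4\<^sup>\<nu>]\<close> contains
  both signs, which gives logarithmically many sign changes.
\<close>

subsection \<open>Fourier coefficients and the operator \<open>T(4)\<close>\<close>

text \<open>The terms of a convergent series are bounded, and at
  \<open>z = \<i> * \<epsilon> / (2 * pi)\<close> the exponential has modulus
  \<open>exp (- \<epsilon> * n)\<close>.\<close>

lemma subexponential_if_q_series_summable: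
  fixes B :: "nat \<Rightarrow> complex"
  assumes "\<And>z. z \<in> upper_half_plane \<Longrightarrow>
             summable (\<lambda>n. B n * exp (2 * of_real pi * \<i> * of_nat n * z))"
    and "\<epsilon> > 0"
  shows "\<exists>M. \<forall>n. norm (B n) \<le> M * exp (\<epsilon> * real n)"
proof -
  define z where "z = \<i> * of_real (\<epsilon> / (2 * pi))"
  have "z \<in> upper_half_plane"
    using assms(2) by (simp add: upper_half_plane_def z_def)
  then have "(\<lambda>n. B n * exp (2 * of_real pi * \<i> * of_nat n * z)) \<longlonglongrightarrow> 0"
    using assms(1) summable_LIMSEQ_zero by blast
  then have "Bseq (\<lambda>n. B n * exp (2 * of_real pi * \<i> * of_nat n * z))"
    using convergentI convergent_imp_Bseq by blast
  then obtain M where M: "\<And>n. norm (B n * exp (2 * of_real pi * \<i> * of_nat n * z)) \<le> M"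
    unfolding Bseq_def by blast
  have "norm (B n) \<le> M * exp (\<epsilon> * real n)" for n
  proof -
    have "norm (exp (2 * of_real pi * \<i> * of_nat n * z)) = exp (- (\<epsilon> * real n))"
      by (simp add: z_def)
    then have "norm (B n) * exp (- (\<epsilon> * real n)) \<le> M"
      using M[of n] by (simp only: norm_mult)
    then show ?thesis
      by (simp add: exp_minus divide_simps)
  qed
  then show ?thesis by blast
qed

text \<open>Half of the decay rate \<open>2 * pi * Im z\<close> pays for the growth of
  \<open>B\<close>; the other half leaves a geometric series. With the preceding bound, pointwise
  convergence on the half plane becomes absolute.\<close>

lemma q_series_summable_if_subexponential:
  fixes B :: "nat \<Rightarrow> complex"
  assumes "\<And>\<epsilon>::real. \<epsilon> > 0 \<Longrightarrow> \<exists>M. \<forall>n. norm (B n) \<le> M * exp (\<epsilon> * real n)"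
    and "z \<in> upper_half_plane"
  shows "summable (\<lambda>n. norm (B n * exp (2 * of_real pi * \<i> * of_nat n * z)))"
proof -
  have y: "Im z > 0" using assms(2) by (simp add: upper_half_plane_def)
  then obtain M where M: "\<And>n. norm (B n) \<le> M * exp (pi * Im z * real n)"
    using assms(1)[of "pi * Im z"] by (metis mult_pos_pos pi_gt_zero)
  have "summable (\<lambda>n. M * exp (- (pi * Im z)) ^ n)"
    using y by (intro summable_mult summable_geometric) simp
  moreover have "norm (norm (B n * exp (2 * of_real pi * \<i> * of_nat n * z)))
      \<le> M * exp (- (pi * Im z)) ^ n" for n
  proof -
    have "norm (B n) * exp (- (2 * pi * real n * Im z))
        \<le> M * exp (pi * Im z * real n) * exp (- (2 * pi * real n * Im z))"
      using M by (intro mult_right_mono) auto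
    also have "\<dots> = M * exp (- (pi * Im z)) ^ n"
      by (simp add: algebra_simps flip: exp_add exp_of_nat_mult)
    finally show ?thesis by (simp add: norm_mult)
  qed
  ultimately show ?thesis by (rule summable_comparison_test'[where N = 0])
qed

section \<open>Recovering coefficients by integration over a period\<close>

lemma exp_2pi_has_integral:
  "((\<lambda>x::real. exp (2 * of_real pi * \<i> * of_int m * of_real x))
     has_integral (if m = 0 then 1 else 0 :: complex)) {0..1}"
proof (cases "m = 0")
  case True
  then show ?thesis using has_integral_const_real[of "1::complex" 0 1] by simp
next
  case False
  define w where "w = 2 * complex_of_real pi * \<i> * of_int m"
  have w: "w \<noteq> 0" using False by (simp add: w_def)
  have "((\<lambda>x. exp (w * of_real x)) has_integral
      (exp (w * of_real 1) / w - exp (w * of_real 0) / w)) {0..1}"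
    using w by (intro fundamental_theorem_of_calculus)
      (auto intro!: derivative_eq_intros has_vector_derivative_real_field)
  moreover have "exp w = 1"
    by (metis exp_2pi_1_int w_def mult.commute mult.left_commute of_int_mult)
  ultimately show ?thesis using False by (simp add: w_def)
qed

text \<open>The plus condition and the Hecke action are stated through an integral; this ties them
  to the coefficients of a given expansion. On the segment at height 1 the series converges
  uniformly, so it can be integrated term by term.\<close>

lemma fourier_coeff_q_series:
  assumes "\<And>z. z \<in> upper_half_plane \<Longrightarrow>
             (\<lambda>n. B n * exp (2 * of_real pi * \<i> * of_nat n * z)) sums g z"
  shows "fourier_coeff g n = B n"
proof -
  define e where "e = (\<lambda>(m::nat) (x::real). exp (2 * of_real pi * \<i> * of_nat m * (of_real x + \<i>)))"
  define e' where "e' = (\<lambda>x::real. exp (- (2 * of_real pi * \<i> * of_nat n * (of_real x + \<i>))))"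
  have sub: "\<exists>M. \<forall>n. norm (B n) \<le> M * exp (\<epsilon> * real n)" if "\<epsilon> > 0" for \<epsilon>
    using assms sums_summable by (intro subexponential_if_q_series_summable that) blast
  have summ: "summable (\<lambda>m. norm (B m * exp (2 * of_real pi * \<i> * of_nat m * \<i>)))"
    by (rule q_series_summable_if_subexponential) (use sub in \<open>auto simp: upper_half_plane_def\<close>)
  have ne': "norm (e' x) = exp (2 * pi * real n)" for x
    by (simp add: e'_def)
  have lim: "uniform_limit {0..1} (\<lambda>N x. \<Sum>m<N. B m * e m x * e' x)
               (\<lambda>x. \<Sum>m. B m * e m x * e' x) sequentially"
    by (rule Weierstrass_m_test[OF _ summable_mult2[OF summ, of "exp (2 * pi * real n)"]])
      (auto simp: e_def norm_mult ne')
  have g: "(\<Sum>m. B m * e m x * e' x) = g (of_real x + \<i>) * e' x" for x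
  proof -
    have "(\<lambda>m. B m * e m x) sums g (of_real x + \<i>)"
      unfolding e_def by (rule assms) (simp add: upper_half_plane_def)
    then show ?thesis using sums_mult2 sums_unique by metis
  qed
  have term_int: "((\<lambda>x. B m * e m x * e' x) has_integral (if m = n then B n else 0)) {0..1}" for m
  proof -
    \<comment> \<open>The height of the segment contributes the real factor, which is 1 in the only
      surviving case \<open>m = n\<close>.\<close>
    have "e m x * e' x = exp (2 * pi * (real n - real m)) *
        exp (2 * of_real pi * \<i> * of_int (int m - int n) * of_real x)" for x
      unfolding e_def e'_def exp_of_real[symmetric] exp_add[symmetric]
      by (rule arg_cong[where f = exp]) (simp add: algebra_simps)
    then have eq: "B m * e m x * e' x = B m * exp (2 * pi * (real n - real m)) *
        exp (2 * of_real pi * \<i> * of_int (int m - int n) * of_real x)" for x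
      by (simp add: mult.assoc)
    show ?thesis
      unfolding eq
      using has_integral_mult_right[OF exp_2pi_has_integral[of "int m - int n"],
          of "B m * exp (2 * pi * (real n - real m))"]
      by (auto split: if_splits)
  qed
  have part: "((\<lambda>x. \<Sum>m<N. B m * e m x * e' x) has_integral (\<Sum>m<N. if m = n then B n else 0)) {0..1}"
    for N by (intro has_integral_sum term_int) auto
  obtain I J where IJ: "\<And>N. ((\<lambda>x. \<Sum>m<N. B m * e m x * e' x) has_integral I N) {0..1}"
      "((\<lambda>x. g (of_real x + \<i>) * e' x) has_integral J) {0..1}" "I \<longlonglongrightarrow> J"
    by (rule uniform_limit_integral[OF lim[unfolded g]])
      (auto intro!: continuous_intros simp: e_def e'_def)
  have "I = (\<lambda>N. \<Sum>m<N. if m = n then B n else 0)"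
    using IJ(1) part has_integral_unique by blast
  moreover have "(\<Sum>m<N. if m = n then B n else 0) = B n" if "N > n" for N
    using that by simp
  ultimately have "I \<longlonglongrightarrow> B n"
    by (intro tendsto_eventually eventually_sequentiallyI[of "Suc n"]) auto
  then have "J = B n" using IJ(3) LIMSEQ_unique by blast
  then show ?thesis
    using IJ(2) unfolding fourier_coeff_def e'_def by (simp add: integral_unique)
qed

lemma norm_hecke_coeff_2_le:
  "norm (hecke_coeff l 2 b n) \<le> norm (b (4 * n)) + 2 ^ (l - 1) * norm (b n)
     + 2 ^ (2 * l - 1) * norm (b (n div 4))"
proof -
  have k: "norm (of_int (kronecker_prime ((-1) ^ l * int n) 2) :: complex) \<le> 1"
    by (simp add: kronecker_prime_def)
  have "norm (of_int (kronecker_prime ((-1) ^ l * int n) 2) * of_nat 2 ^ (l - 1) * b n)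
      \<le> 1 * 2 ^ (l - 1) * norm (b n)"
    unfolding norm_mult by (intro mult_mono k) (auto simp: norm_power)
  moreover have "norm (of_nat 2 ^ (2 * l - 1) * (if 2\<^sup>2 dvd n then b (n div 2\<^sup>2) else 0))
      \<le> 2 ^ (2 * l - 1) * norm (b (n div 4))"
    by (simp add: norm_mult norm_power)
  ultimately have "norm (of_int (kronecker_prime ((-1) ^ l * int n) 2) * of_nat 2 ^ (l - 1) * b n)
      + norm (of_nat 2 ^ (2 * l - 1) * (if 2\<^sup>2 dvd n then b (n div 2\<^sup>2) else 0))
      \<le> 2 ^ (l - 1) * norm (b n) + 2 ^ (2 * l - 1) * norm (b (n div 4))"
    by linarith
  moreover have "norm (b (2\<^sup>2 * n)) = norm (b (4 * n))" by simp
  ultimately show ?thesis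
    unfolding hecke_coeff_def
    by (smt (verit) norm_triangle_ineq norm_ge_zero norm_zero zero_le_mult_iff zero_le_power)
qed

text \<open>Uniqueness of coefficients turns the eigenvalue equation for functions into one for
  sequences. As \<open>hecke\<close> is a bare infinite sum, its convergence comes first: the
  operator preserves subexponential growth.\<close>

lemma hecke_coeff_2_eigen:
  assumes q: "\<And>z. z \<in> upper_half_plane \<Longrightarrow>
             (\<lambda>n. b n * exp (2 * of_real pi * \<i> * of_nat n * z)) sums f z"
    and ev: "\<And>z. z \<in> upper_half_plane \<Longrightarrow> hecke l 2 f z = ev * f z"
  shows "hecke_coeff l 2 b n = ev * b n"
proof -
  have b: "fourier_coeff f = b"
    using fourier_coeff_q_series[OF q] by blast
  have "\<exists>M. \<forall>n. norm (hecke_coeff l 2 b n) \<le> M * exp (\<epsilon> * real n)" if "\<epsilon> > 0" for \<epsilon>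
  proof -
    \<comment> \<open>The rate is divided by 4 because the operator reads the coefficient of index
      \<open>4 * n\<close>.\<close>
    have "\<epsilon> / 4 > 0" using that by simp
    with sums_summable[OF q] obtain M where M: "\<And>n. norm (b n) \<le> M * exp (\<epsilon> / 4 * real n)"
      using subexponential_if_q_series_summable by blast
    have "M \<ge> 0" using order_trans[OF norm_ge_zero M[of 0]] by simp
    have *: "norm (b m) \<le> M * exp (\<epsilon> * real n)" if "m \<le> 4 * n" for m n
    proof -
      have "\<epsilon> / 4 * real m \<le> \<epsilon> / 4 * real (4 * n)"
        using that \<open>\<epsilon> > 0\<close> by (intro mult_left_mono) linarith+
      then have "exp (\<epsilon> / 4 * real m) \<le> exp (\<epsilon> * real n)" by simp
      then show ?thesis
        using order_trans[OF M[of m]] mult_left_mono[OF _ \<open>M \<ge> 0\<close>] by blast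
    qed
    have "norm (hecke_coeff l 2 b n) \<le> M * exp (\<epsilon> * real n) + 2 ^ (l - 1) * (M * exp (\<epsilon> * real n))
        + 2 ^ (2 * l - 1) * (M * exp (\<epsilon> * real n))" for n
      by (intro order_trans[OF norm_hecke_coeff_2_le] add_mono mult_left_mono *) auto
    then have "norm (hecke_coeff l 2 b n) \<le> (M + 2 ^ (l - 1) * M + 2 ^ (2 * l - 1) * M) * exp (\<epsilon> * real n)" for n
      by (simp add: algebra_simps)
    then show ?thesis by blast
  qed
  then have "(\<lambda>n. hecke_coeff l 2 b n * exp (2 * of_real pi * \<i> * of_nat n * z)) sums hecke l 2 f z"
    if "z \<in> upper_half_plane" for z
    unfolding hecke_def b
    using that by (intro summable_sums summable_norm_cancel[OF q_series_summable_if_subexponential])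
  then have "fourier_coeff (\<lambda>z. ev * f z) n = hecke_coeff l 2 b n"
    by (intro fourier_coeff_q_series) (simp flip: ev)
  moreover have "fourier_coeff (\<lambda>z. ev * f z) n = ev * b n"
  proof (rule fourier_coeff_q_series)
    fix z assume "z \<in> upper_half_plane"
    then show "(\<lambda>n. ev * b n * exp (2 * of_real pi * \<i> * of_nat n * z)) sums (ev * f z)"
      using sums_mult[OF q, of z ev] by (simp add: mult.assoc)
  qed
  ultimately show ?thesis by simp
qed

subsection \<open>The cusp \<open>1/4\<close>\<close>

lemma has_sum_power_nat_abs:
  fixes r :: real
  assumes "0 \<le> r" "r < 1"
  shows "((\<lambda>m::int. r ^ nat \<bar>m\<bar>) has_sum (2 * (r / (1 - r)))) (- {0})"
proof -
  have "((\<lambda>m::int. r ^ nat \<bar>m\<bar>) has_sum (r / (1 - r))) {1..}"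
    using has_sum_geometric_from_1[of r] assms
    by (subst has_sum_reindex_bij_witness[of _ int nat "{1..}" "\<lambda>n. r ^ n"]) auto
  moreover have "((\<lambda>m::int. r ^ nat \<bar>m\<bar>) has_sum (r / (1 - r))) {..-1}"
    using has_sum_geometric_from_1[of r] assms
    by (subst has_sum_reindex_bij_witness[of _ "\<lambda>n. - int n" "\<lambda>m. nat (- m)" "{1..}" "\<lambda>n. r ^ n"]) auto
  ultimately have "((\<lambda>m::int. r ^ nat \<bar>m\<bar>) has_sum (r / (1 - r) + r / (1 - r))) ({1..} \<union> {..-1})"
    by (intro has_sum_Un_disjoint) auto
  moreover have "{1..} \<union> {..-1} = - {0::int}" by auto
  ultimately show ?thesis by simp
qed

text \<open>Since squares of integers dominate absolute values, the nonconstant terms are bounded by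
  a geometric series. The one bound serves twice: high up it keeps theta away from 0, near the real
  line it limits the growth to order \<open>1 / Im z\<close>.\<close>

lemma norm_theta_minus_1_le:
  assumes y: "Im z > 0"
  shows "norm (theta z - 1) \<le> 1 / (pi * Im z)"
proof -
  define t where "t = (\<lambda>m::int. exp (2 * of_real pi * \<i> * of_int (m\<^sup>2) * z))"
  define r where "r = exp (- (2 * pi * Im z))"
  have r: "0 \<le> r" "r < 1" using y by (auto simp: r_def)
  have t_le: "norm (t m) \<le> r ^ nat \<bar>m\<bar>" for m
  proof -
    have "m = 0 \<or> 1 \<le> \<bar>m\<bar>" by linarith
    then have "\<bar>m\<bar> \<le> \<bar>m\<bar>\<^sup>2"
      using self_le_power[of "\<bar>m\<bar>" 2] by auto
    then have "real_of_int \<bar>m\<bar> \<le> real_of_int (m\<^sup>2)" by (simp only: of_int_le_iff power2_abs)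
    then have "(2 * pi * Im z) * real_of_int \<bar>m\<bar> \<le> (2 * pi * Im z) * real_of_int (m\<^sup>2)"
      using y by (intro mult_left_mono) auto
    then have "norm (t m) \<le> exp (real (nat \<bar>m\<bar>) * - (2 * pi * Im z))"
      by (simp add: t_def algebra_simps)
    then show ?thesis by (simp only: r_def exp_of_nat_mult)
  qed
  note geo = has_sum_power_nat_abs[OF r]
  have summ: "t summable_on - {0}"
    by (rule abs_summable_summable, rule Infinite_Sum.abs_summable_on_comparison_test')
      (rule has_sum_imp_summable[OF geo], rule t_le)
  have "theta z = t 0 + infsum t (- {0})"
    using infsum_insert[OF summ, of 0] insert_UNIV[of "0::int"]
    by (simp add: theta_def t_def Compl_eq_Diff_UNIV)
  then have "theta z - 1 = infsum t (- {0})" by (simp add: t_def)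
  also have "norm \<dots> \<le> 2 * (r / (1 - r))"
    using norm_infsum_le[OF has_sum_infsum[OF summ] geo t_le] .
  also have "\<dots> \<le> 1 / (pi * Im z)"
  proof -
    have "1 + 2 * pi * Im z \<le> exp (2 * pi * Im z)" by (rule exp_ge_add_one_self)
    then have "r * (1 + 2 * pi * Im z) \<le> r * exp (2 * pi * Im z)"
      using r by (intro mult_left_mono) auto
    also have "\<dots> = 1" by (simp add: r_def flip: exp_add)
    finally have "r * (2 * pi * Im z) \<le> 1 - r" by (simp add: algebra_simps)
    then show ?thesis using r y by (simp add: field_simps)
  qed
  finally show ?thesis .
qed

text \<open>Without a constant term all exponents are at least 1, so the decay gained above height 1
  can be pulled out of the sum at the rate of the term \<open>n = 1\<close>.\<close>

lemma norm_q_series_le: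
  assumes q: "\<And>z. z \<in> upper_half_plane \<Longrightarrow>
             (\<lambda>n. b n * exp (2 * of_real pi * \<i> * of_nat n * z)) sums f z"
    and summ: "summable (\<lambda>n. norm (b n) * exp (- (2 * pi * real n)))"
    and "b 0 = 0" "Im z \<ge> 1"
  shows "norm (f z) \<le> exp (- (2 * pi * (Im z - 1))) * (\<Sum>n. norm (b n) * exp (- (2 * pi * real n)))"
proof -
  have le: "norm (b n * exp (2 * of_real pi * \<i> * of_nat n * z))
      \<le> exp (- (2 * pi * (Im z - 1))) * (norm (b n) * exp (- (2 * pi * real n)))" for n
  proof (cases "n = 0")
    case True
    then show ?thesis using assms(3) by simp
  next
    case False
    then have "2 * pi * (Im z - 1) * 1 \<le> 2 * pi * (Im z - 1) * real n"
      using assms(4) by (intro mult_left_mono) auto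
    then have "exp (- (2 * pi * real n * Im z)) \<le> exp (- (2 * pi * (Im z - 1))) * exp (- (2 * pi * real n))"
      unfolding exp_add[symmetric] exp_le_cancel_iff by (simp add: algebra_simps)
    from mult_left_mono[OF this, of "norm (b n)"] show ?thesis
      by (simp add: norm_mult mult.left_commute)
  qed
  have z: "z \<in> upper_half_plane" using assms(4) by (simp add: upper_half_plane_def)
  have "norm (f z) = norm (\<Sum>n. b n * exp (2 * of_real pi * \<i> * of_nat n * z))"
    using sums_unique[OF q[OF z]] by simp
  also have "\<dots> \<le> (\<Sum>n. exp (- (2 * pi * (Im z - 1))) * (norm (b n) * exp (- (2 * pi * real n))))"
    by (rule norm_suminf_le[OF le summable_mult[OF summ]])
  also have "\<dots> = exp (- (2 * pi * (Im z - 1))) * (\<Sum>n. norm (b n) * exp (- (2 * pi * real n)))"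
    by (rule suminf_mult[OF summ])
  finally show ?thesis .
qed

text \<open>
  The cusp \<open>1/4\<close> is equivalent to infinity, so the exponential decay of \<open>f\<close> at infinity
  carries over to it: the automorphy factor, a ratio of theta values, grows only polynomially.
\<close>

lemma tendsto_0_at_cusp_quarter:
  assumes q: "\<And>z. z \<in> upper_half_plane \<Longrightarrow>
             (\<lambda>n. b n * exp (2 * of_real pi * \<i> * of_nat n * z)) sums f z"
    and "b 0 = 0"
    and trans: "\<And>z. z \<in> upper_half_plane \<Longrightarrow>
             f (moebius 1 0 4 1 z) = theta_factor 1 0 4 1 z ^ m * f z"
  shows "((\<lambda>Y. f (1 / 4 + \<i> * of_real (1 / (16 * Y)))) \<longlongrightarrow> 0) at_top"
proof -
  have "summable (\<lambda>n. norm (b n * exp (2 * of_real pi * \<i> * of_nat n * \<i>)))"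
    using q by (intro q_series_summable_if_subexponential subexponential_if_q_series_summable)
      (auto simp: upper_half_plane_def intro: sums_summable)
  then have summ: "summable (\<lambda>n. norm (b n) * exp (- (2 * pi * real n)))"
    by (simp add: norm_mult)
  define S where "S = (\<Sum>n. norm (b n) * exp (- (2 * pi * real n)))"
  have S: "S \<ge> 0" unfolding S_def by (intro suminf_nonneg summ) auto
  \<comment> \<open>The 34 arises as \<open>17 * Y\<close> over \<open>1 / 2\<close>, the bounds for
    the two theta values; \<open>exp (2 * pi)\<close> makes up for the decay being measured from
    height 1.\<close>
  have bound: "norm (f (1 / 4 + \<i> * of_real (1 / (16 * Y)))) \<le> 34 ^ m * exp (2 * pi) * S * (Y ^ m / exp Y)"
    if Y: "Y \<ge> 1" for Y
  proof -
    \<comment> \<open>This real part makes \<open>4 * z + 1\<close> purely imaginary, so the image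
      lies exactly above the cusp \<open>1/4\<close>.\<close>
    define z where "z = - (1 / 4) + \<i> * of_real Y"
    have z: "z \<in> upper_half_plane" "Im z = Y" using Y by (auto simp: z_def upper_half_plane_def)
    have z': "moebius 1 0 4 1 z = 1 / 4 + \<i> * of_real (1 / (16 * Y))"
      using Y by (simp add: moebius_def z_def field_simps)
    have "norm (theta z - 1) \<le> 1 / (pi * Y)"
      using norm_theta_minus_1_le[of z] z Y by simp
    also have "\<dots> \<le> 1 / 2"
    proof -
      have "2 * 1 \<le> pi * Y" using Y pi_gt3 by (intro mult_mono) auto
      then show ?thesis by (simp add: field_simps)
    qed
    finally have lower: "norm (theta z) \<ge> 1 / 2"
      using norm_triangle_ineq2[of 1 "1 - theta z"] by (simp add: norm_minus_commute)
    have "norm (theta (moebius 1 0 4 1 z) - 1) \<le> 1 / (pi * (1 / (16 * Y)))"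
      using norm_theta_minus_1_le[of "moebius 1 0 4 1 z"] Y by (simp add: z')
    also have "\<dots> \<le> 16 * Y"
      using Y pi_gt3 by (simp add: field_simps)
    finally have upper: "norm (theta (moebius 1 0 4 1 z)) \<le> 17 * Y"
      using norm_triangle_ineq2[of "theta (moebius 1 0 4 1 z)" 1] Y by simp
    have decay: "exp (- (2 * pi * (Y - 1))) \<le> exp (2 * pi) * exp (- Y)"
    proof -
      have "1 * Y \<le> 2 * pi * Y" using Y pi_gt3 by (intro mult_right_mono) auto
      then show ?thesis by (simp add: algebra_simps flip: exp_add)
    qed
    have "norm (theta_factor 1 0 4 1 z) \<le> 17 * Y / (1 / 2)"
      unfolding theta_factor_def norm_divide using lower upper Y by (intro frac_le) auto
    then have "norm (theta_factor 1 0 4 1 z) ^ m \<le> (34 * Y) ^ m"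
      by (intro power_mono) auto
    moreover have "norm (f z) \<le> exp (- (2 * pi * (Y - 1))) * S"
      using norm_q_series_le[OF q summ \<open>b 0 = 0\<close>, of z] z Y by (simp add: S_def)
    ultimately have "norm (f (moebius 1 0 4 1 z)) \<le> (34 * Y) ^ m * (exp (- (2 * pi * (Y - 1))) * S)"
      unfolding trans[OF z(1)] norm_mult norm_power using Y by (intro mult_mono) auto
    also have "\<dots> \<le> (34 * Y) ^ m * (exp (2 * pi) * exp (- Y) * S)"
      using decay S Y by (intro mult_left_mono mult_right_mono) auto
    also have "\<dots> = 34 ^ m * exp (2 * pi) * S * (Y ^ m / exp Y)"
      by (simp add: power_mult_distrib exp_minus divide_inverse mult_ac)
    finally show ?thesis by (simp only: z')
  qed
  have "\<forall>\<^sub>F Y in at_top. norm (f (1 / 4 + \<i> * of_real (1 / (16 * Y))))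
      \<le> 34 ^ m * exp (2 * pi) * S * (Y ^ m / exp Y)"
    using eventually_ge_at_top[of "1::real"] by (rule eventually_mono) (rule bound)
  moreover have "((\<lambda>Y. 34 ^ m * exp (2 * pi) * S * (Y ^ m / exp Y)) \<longlongrightarrow> 0) at_top"
    using tendsto_mult_right_zero[OF tendsto_power_div_exp_0] by blast
  ultimately show ?thesis by (rule Lim_null_comparison)
qed

text \<open>The power is 1 for \<open>n\<close> divisible by 4 and \<open>(-1) ^ l * \<i>\<close>
  for \<open>n\<close> congruent to \<open>(-1) ^ l\<close>, the only residues allowed modulo
  4.\<close>

lemma Re_plus_Im_i_power_plus_index:
  assumes "plus_index l n"
  shows "Re (\<i> ^ n) + (-1) ^ l * Im (\<i> ^ n) = 1"
proof -
  have "n = 4 * (n div 4) + n mod 4" by simp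
  then have "\<i> ^ n = (\<i> ^ 4) ^ (n div 4) * \<i> ^ (n mod 4)"
    by (metis power_add power_mult)
  then have i: "\<i> ^ n = \<i> ^ (n mod 4)" by simp
  have "n mod 4 = 0 \<or> (even l \<and> n mod 4 = 1) \<or> (odd l \<and> n mod 4 = 3)"
    using assms unfolding plus_index_def by (cases "even l") (simp_all, presburger+)
  then show ?thesis unfolding i by (auto simp: power3_eq_cube)
qed

text \<open>
  As \<open>z = 1/4 + i y\<close> tends to the cusp \<open>1/4\<close>, the terms with \<open>n \<equiv> 0 (mod 4)\<close> are real and those with
  \<open>n \<equiv> (-1)\<^sup>l (mod 4)\<close> are a fixed sign times \<open>\<i>\<close>. So \<open>Re + (-1)\<^sup>l Im\<close> turns \<open>f z\<close> into
  the sum of the coefficients weighted by \<open>e\<^sup>-\<^sup>2\<^sup>\<pi>\<^sup>n\<^sup>y\<close>, which tends to 0.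
\<close>

lemma plus_form_coeff_nonpos:
  assumes q: "\<And>z. z \<in> upper_half_plane \<Longrightarrow>
             (\<lambda>n. of_real (\<beta> n) * exp (2 * of_real pi * \<i> * of_nat n * z)) sums f z"
    and "\<beta> 0 = 0"
    and trans: "\<And>z. z \<in> upper_half_plane \<Longrightarrow>
             f (moebius 1 0 4 1 z) = theta_factor 1 0 4 1 z ^ m * f z"
    and plus: "\<And>n. \<not> plus_index l n \<Longrightarrow> \<beta> n = 0"
    and nonneg: "\<And>n. \<beta> n \<ge> 0"
  shows "\<beta> n \<le> 0"
proof -
  define F where "F = (\<lambda>Y. f (1 / 4 + \<i> * of_real (1 / (16 * Y))))"
  define L where "L = (\<lambda>w. Re w + (-1) ^ l * Im w)"
  have F: "(F \<longlongrightarrow> 0) at_top"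
    unfolding F_def by (rule tendsto_0_at_cusp_quarter[OF q _ trans]) (use \<open>\<beta> 0 = 0\<close> in auto)
  have "bounded_linear L"
    unfolding L_def
    by (intro bounded_linear_add bounded_linear_Re bounded_linear_const_mult bounded_linear_Im)
  note L = bounded_linear.sums[OF this]
  \<comment> \<open>A series of nonnegative terms is at least each single term; in the limit the
    term becomes \<open>\<beta> n\<close> and the series 0.\<close>
  have lower: "\<beta> n * exp (- (2 * pi * real n * (1 / (16 * Y)))) \<le> L (F Y)" if Y: "Y > 0" for Y
  proof -
    define z where "z = 1 / 4 + \<i> * of_real (1 / (16 * Y))"
    have z: "z \<in> upper_half_plane" using Y by (simp add: z_def upper_half_plane_def)
    have term_eq: "L (of_real (\<beta> k) * exp (2 * of_real pi * \<i> * of_nat k * z))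
        = \<beta> k * exp (- (2 * pi * real k * (1 / (16 * Y))))" for k
    proof (cases "plus_index l k")
      case True
      have "2 * of_real pi * \<i> * of_nat k * z
          = of_nat k * (of_real pi / 2 * \<i>) + of_real (- (2 * pi * real k * (1 / (16 * Y))))"
        using Y by (simp add: z_def algebra_simps)
      moreover have "exp (of_real pi / 2 * \<i>) = \<i>"
        using cis_conv_exp[of "pi / 2"] by (simp add: mult.commute)
      ultimately have "exp (2 * of_real pi * \<i> * of_nat k * z)
          = \<i> ^ k * of_real (exp (- (2 * pi * real k * (1 / (16 * Y)))))"
        by (simp only: exp_add exp_of_nat_mult exp_of_real)
      then have "L (of_real (\<beta> k) * exp (2 * of_real pi * \<i> * of_nat k * z))
          = \<beta> k * exp (- (2 * pi * real k * (1 / (16 * Y)))) * (Re (\<i> ^ k) + (-1) ^ l * Im (\<i> ^ k))"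
        by (simp add: L_def algebra_simps)
      then show ?thesis by (simp add: Re_plus_Im_i_power_plus_index[OF True])
    next
      case False
      then show ?thesis using plus by (simp add: L_def)
    qed
    have total: "(\<lambda>k. \<beta> k * exp (- (2 * pi * real k * (1 / (16 * Y))))) sums L (F Y)"
      using L[OF q[OF z]] unfolding term_eq by (simp add: F_def z_def)
    have single: "(\<lambda>k. if k = n then \<beta> n * exp (- (2 * pi * real n * (1 / (16 * Y)))) else 0)
        sums (\<beta> n * exp (- (2 * pi * real n * (1 / (16 * Y)))))"
      using sums_single[of n "\<lambda>_. \<beta> n * exp (- (2 * pi * real n * (1 / (16 * Y))))"] by simp
    show ?thesis
      by (rule sums_le[OF _ single total]) (use nonneg in auto)
  qed
  have inv: "((\<lambda>Y::real. 1 / (16 * Y)) \<longlongrightarrow> 0) at_top"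
    by (intro tendsto_divide_0[OF tendsto_const] filterlim_at_top_imp_at_infinity
        filterlim_tendsto_pos_mult_at_top[OF tendsto_const _ filterlim_ident]) simp
  have lim: "((\<lambda>Y. \<beta> n * exp (- (2 * pi * real n * (1 / (16 * Y))))) \<longlongrightarrow> \<beta> n * exp (- (2 * pi * real n * 0))) at_top"
    by (intro tendsto_intros inv)
  have LF: "((\<lambda>Y. L (F Y)) \<longlongrightarrow> L 0) at_top"
    unfolding L_def by (intro tendsto_intros F)
  have "\<forall>\<^sub>F Y in at_top. \<beta> n * exp (- (2 * pi * real n * (1 / (16 * Y)))) \<le> L (F Y)"
    using eventually_gt_at_top[of "0::real"] by (rule eventually_mono) (rule lower)
  then have "\<beta> n * exp (- (2 * pi * real n * 0)) \<le> L 0"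
    by (rule tendsto_le[OF _ LF lim, rotated]) simp
  then show ?thesis by (simp add: L_def)
qed

subsection \<open>Signs of solutions of a linear recurrence\<close>

text \<open>Convexity: for \<open>\<mu> \<ge> 2\<close> and positive values the increments never
  decrease, and \<open>\<nu> \<ge> 1\<close> makes the first one nonnegative.\<close>

lemma recurrence_same_sign:
  fixes u :: "nat \<Rightarrow> real"
  assumes rec: "\<And>n. u (n + 2) = \<mu> * u (n + 1) - u n"
    and "u 1 = \<nu> * u 0" "\<nu> \<ge> 1" "\<mu> \<ge> 2" "u 0 > 0"
  shows "u n > 0"
proof -
  have "u n > 0 \<and> u (n + 1) \<ge> u n"
  proof (induction n)
    case 0
    have "1 * u 0 \<le> \<nu> * u 0" using assms by (intro mult_right_mono) auto
    then show ?case using assms by simp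
  next
    case (Suc n)
    have "2 * u (n + 1) \<le> \<mu> * u (n + 1)"
      using Suc assms(4) by (intro mult_right_mono) auto
    with Suc rec[of n] have "u (n + 2) \<ge> u (n + 1)" "u (n + 1) > 0" by linarith+
    then show ?case by simp
  qed
  then show ?thesis by simp
qed

text \<open>
  For \<open>\<bar>\<mu>\<bar> < 2\<close> the form \<open>u\<^sub>n\<^sup>2 - \<mu> u\<^sub>n u\<^sub>n\<^sub>+\<^sub>1 + u\<^sub>n\<^sub>+\<^sub>1\<^sup>2\<close> is a positive definite invariant, so the sum of
  \<open>u\<^sub>n\<^sup>2\<close> over a window grows linearly in its length, whereas the sum of \<open>u\<^sub>n\<close> telescopes up to the
  factor \<open>2 - \<mu>\<close> and stays bounded. On a window without negative terms, the first sum is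
  bounded by a multiple of the second.
\<close>

lemma recurrence_elliptic_negative:
  fixes u :: "nat \<Rightarrow> real"
  assumes rec: "\<And>n. u (n + 2) = \<mu> * u (n + 1) - u n"
    and "u 0 \<noteq> 0" "-2 < \<mu>" "\<mu> < 2"
  shows "\<exists>K. \<forall>n. \<exists>i\<in>{n..n + K}. u i < 0"
proof -
  define Q where "Q = (\<lambda>n. (u n)\<^sup>2 - \<mu> * u n * u (n + 1) + (u (n + 1))\<^sup>2)"
  have Q: "Q n = Q 0" for n
  proof (induction n)
    case (Suc n)
    have "Q (Suc n) = Q n"
      using rec[of n] by (simp add: Q_def) (simp add: power2_eq_square algebra_simps)
    with Suc show ?case by simp
  qed simp
  \<comment> \<open>The smaller eigenvalue of the quadratic form, positive exactly because
    \<open>\<bar>\<mu>\<bar> < 2\<close>.\<close>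
  define c where "c = (2 - \<bar>\<mu>\<bar>) / 2"
  have c: "c > 0" "\<bar>\<mu>\<bar> \<le> 2" using assms by (auto simp: c_def)
  have mixed: "\<bar>\<mu> * u n * u (n + 1)\<bar> \<le> \<bar>\<mu>\<bar> * (((u n)\<^sup>2 + (u (n + 1))\<^sup>2) / 2)" for n
    using sum_squares_bound[of "\<bar>u n\<bar>" "\<bar>u (n + 1)\<bar>"]
    by (simp add: abs_mult mult.assoc mult_left_mono)
  have Q_lower: "c * ((u n)\<^sup>2 + (u (n + 1))\<^sup>2) \<le> Q n" for n
    using mixed[of n] by (simp add: c_def Q_def field_simps abs_le_iff)
  have Q_upper: "Q n \<le> 2 * ((u n)\<^sup>2 + (u (n + 1))\<^sup>2)" for n
  proof -
    have "\<bar>\<mu>\<bar> * (((u n)\<^sup>2 + (u (n + 1))\<^sup>2) / 2) \<le> 2 * (((u n)\<^sup>2 + (u (n + 1))\<^sup>2) / 2)"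
      using c by (intro mult_right_mono) auto
    with mixed[of n] show ?thesis by (simp add: Q_def abs_le_iff)
  qed
  \<comment> \<open>As \<open>Q\<close> is at most twice the sum of two consecutive squares, every
    such sum is at least \<open>q\<close>.\<close>
  define q where "q = Q 0 / 2"
  have "0 < c * ((u 0)\<^sup>2 + (u (0 + 1))\<^sup>2)"
    using c assms(2) by (simp add: sum_power2_gt_zero_iff)
  with Q_lower[of 0] have q: "q > 0" by (simp add: q_def)
  have sq: "q \<le> (u n)\<^sup>2 + (u (n + 1))\<^sup>2" for n
    using Q_upper[of n] Q[of n] by (simp add: q_def)
  define M where "M = sqrt (Q 0 / c)"
  have M: "\<bar>u n\<bar> \<le> M" for n
  proof -
    have "c * (u n)\<^sup>2 \<le> c * ((u n)\<^sup>2 + (u (n + 1))\<^sup>2)"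
      using c by (intro mult_left_mono) auto
    then have "(u n)\<^sup>2 \<le> Q 0 / c"
      using order_trans[OF _ Q_lower[of n]] Q[of n] c by (metis le_divide_eq mult.commute)
    then show ?thesis unfolding M_def by (metis real_le_rsqrt power2_abs)
  qed
  have tele: "(2 - \<mu>) * (\<Sum>j<N. u (n + j + 1)) = (u (n + 1) - u n) - (u (n + N + 1) - u (n + N))" for n N
  proof (induction N)
    case (Suc N)
    then show ?case using rec[of "n + N"] by (simp add: algebra_simps)
  qed simp
  have sum_sq: "q * real N \<le> (\<Sum>j<2 * N. (u (n + j + 1))\<^sup>2)" for n N
  proof (induction N)
    case (Suc N)
    then show ?case using sq[of "n + 2 * N + 1"] by (simp add: algebra_simps)
  qed simp
  \<comment> \<open>Chosen so that the lower bound \<open>q * N\<close> for the squares beats the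
    telescoped sum: four boundary terms of size \<open>M\<close>, times the factor \<open>M\<close>
    from comparing squares with values.\<close>
  obtain N :: nat where N: "real N > 4 * M * M / ((2 - \<mu>) * q)"
    using reals_Archimedean2 by blast
  have "\<exists>i\<in>{n..n + 2 * N}. u i < 0" for n
  proof (rule ccontr)
    assume "\<not> ?thesis"
    then have nonneg: "u i \<ge> 0" if "i \<in> {n..n + 2 * N}" for i
      using that not_le by blast
    have "q * real N \<le> (\<Sum>j<2 * N. (u (n + j + 1))\<^sup>2)" by (rule sum_sq)
    also have "\<dots> \<le> (\<Sum>j<2 * N. M * u (n + j + 1))"
    proof (rule sum_mono)
      fix j assume "j \<in> {..<2 * N}"
      then have "u (n + j + 1) \<ge> 0" by (intro nonneg) auto
      then show "(u (n + j + 1))\<^sup>2 \<le> M * u (n + j + 1)"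
        using M[of "n + j + 1"] unfolding power2_eq_square by (intro mult_right_mono) auto
    qed
    finally have "(2 - \<mu>) * (q * real N) \<le> (2 - \<mu>) * (M * (\<Sum>j<2 * N. u (n + j + 1)))"
      using assms by (intro mult_left_mono) (auto simp: sum_distrib_left)
    also have "\<dots> = M * ((u (n + 1) - u n) - (u (n + 2 * N + 1) - u (n + 2 * N)))"
      by (subst mult.left_commute) (simp only: tele)
    also have "\<dots> \<le> M * (4 * M)"
    proof (rule mult_left_mono)
      show "u (n + 1) - u n - (u (n + 2 * N + 1) - u (n + 2 * N)) \<le> 4 * M"
        using M[of n] M[of "n + 1"] M[of "n + 2 * N"] M[of "n + 2 * N + 1"] by linarith
      show "M \<ge> 0" using M[of 0] by linarith
    qed
    also have "\<dots> < (2 - \<mu>) * (q * real N)"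
      using N q assms by (simp add: field_simps)
    finally show False by simp
  qed
  then show ?thesis by blast
qed

text \<open>For \<open>\<mu> \<le> -2\<close> the twist by \<open>(-1) ^ n\<close> gives a
  recurrence with parameter \<open>- \<mu> \<ge> 2\<close>, whose solution keeps its sign;
  \<open>\<bar>\<delta>\<bar> \<le> 1\<close> ensures the required first step. Otherwise the
  elliptic case applies to \<open>u\<close> and to its negative.\<close>

lemma recurrence_both_signs:
  fixes u :: "nat \<Rightarrow> real"
  assumes rec: "\<And>n. u (n + 2) = \<mu> * u (n + 1) - u n"
    and "u 1 = (\<mu> - \<delta>) * u 0" "\<bar>\<delta>\<bar> \<le> 1" "\<mu> < 2" "u 0 \<noteq> 0"
  shows "\<exists>K. \<forall>n. \<exists>i\<in>{n..n + K}. \<exists>j\<in>{n..n + K}. u i > 0 \<and> u j < 0"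
proof (cases "\<mu> \<le> -2")
  case True
  define v where "v = (\<lambda>n. sgn (u 0) * (-1) ^ n * u n)"
  have v: "v n > 0" for n
  proof (rule recurrence_same_sign)
    show "v (n + 2) = (- \<mu>) * v (n + 1) - v n" for n
      using rec[of n] by (simp add: v_def) (simp add: algebra_simps)
    show "v 1 = (\<delta> - \<mu>) * v 0" unfolding v_def assms(2) by (simp add: algebra_simps)
    show "v 0 > 0" using assms(5) by (simp add: v_def sgn_if)
  qed (use True assms in auto)
  have "\<exists>i\<in>{n..n + 1}. \<exists>j\<in>{n..n + 1}. u i > 0 \<and> u j < 0" for n
  proof -
    have "sgn (u 0) = 1 \<or> sgn (u 0) = -1" using assms(5) by (simp add: sgn_if)
    moreover have "(-1) ^ n = (1::real) \<or> (-1) ^ n = (-1::real)"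
      using neg_one_even_power neg_one_odd_power by blast
    ultimately have "u n > 0 \<and> u (n + 1) < 0 \<or> u n < 0 \<and> u (n + 1) > 0"
      using v[of n] v[of "n + 1"] unfolding v_def by auto
    then show ?thesis by auto
  qed
  then show ?thesis by blast
next
  case False
  then obtain K where K: "\<And>n. \<exists>i\<in>{n..n + K}. u i < 0"
    using recurrence_elliptic_negative[of u \<mu>] assms by auto
  have "- u (n + 2) = \<mu> * - u (n + 1) - - u n" for n
    using rec by simp
  then obtain K' where K': "\<And>n. \<exists>i\<in>{n..n + K'}. - u i < 0"
    using recurrence_elliptic_negative[of "\<lambda>n. - u n" \<mu>] assms False by auto
  have "\<exists>i\<in>{n..n + max K K'}. \<exists>j\<in>{n..n + max K K'}. u i > 0 \<and> u j < 0" for n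
    using K[of n] K'[of n] by fastforce
  then show ?thesis by blast
qed

subsection \<open>Counting sign changes\<close>

text \<open>A nonzero value strictly between has sign opposite to one of the two ends, so the
  interval can be shortened until only zeros remain inside.\<close>

lemma sign_change_between:
  assumes "i \<in> A" "j \<in> A" "i < j" "s i * s j < 0"
  obtains m n where "(m, n) \<in> sign_changes A s" "i \<le> m" "n \<le> j"
proof -
  have "\<exists>m n. (m, n) \<in> sign_changes A s \<and> i \<le> m \<and> n \<le> j"
    using assms
  proof (induction "j - i" arbitrary: i j rule: less_induct)
    case less
    show ?case
    proof (cases "\<exists>h\<in>A. i < h \<and> h < j \<and> s h \<noteq> 0")
      case False
      then show ?thesis using less.prems by (auto simp: sign_changes_def)
    next
      case True
      then obtain h where h: "h \<in> A" "i < h" "h < j" "s h \<noteq> 0" by blast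
      have "s i * s h < 0 \<or> s h * s j < 0"
        using h(4) less.prems(4) by (auto simp: mult_less_0_iff)
      then show ?thesis
      proof
        assume "s i * s h < 0"
        with less.hyps[of h i] less.prems h show ?thesis by fastforce
      next
        assume "s h * s j < 0"
        with less.hyps[of j h] less.prems h show ?thesis by fastforce
      qed
    qed
  qed
  then show thesis using that by blast
qed

text \<open>The disjoint blocks from \<open>B ^ q\<close> to \<open>B ^ Suc q\<close> each contain a
  complete sign change, so the count up to \<open>x\<close> is at least the integer part of the
  logarithm of \<open>x\<close> to base \<open>B\<close>.\<close>

lemma sign_change_count_bigomega_ln:
  assumes "D \<ge> 1"
    and both: "\<And>v. \<exists>i\<in>A. \<exists>j\<in>A. i \<in> {4 ^ v..D * 4 ^ v} \<and> j \<in> {4 ^ v..D * 4 ^ v} \<and> s i > 0 \<and> s j < 0"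
  shows "infinite (sign_changes A s)"
    and "(\<lambda>x::real. real (sign_change_count A s x)) \<in> \<Omega>(\<lambda>x. ln x)"
proof -
  \<comment> \<open>A power of 4, so that \<open>both\<close> applies at \<open>B ^ q\<close>, and
    larger than \<open>D\<close>, so that the interval found there stays inside the block.\<close>
  define B where "B = (4::nat) ^ Suc D"
  have "D < 2 ^ Suc D" by (metis less_exp lessI less_trans)
  also have "\<dots> \<le> B" unfolding B_def by (intro power_mono) auto
  finally have DB: "D < B" .
  have "\<exists>m n. (m, n) \<in> sign_changes A s \<and> B ^ q \<le> m \<and> n < B ^ Suc q" for q
  proof -
    have Bq: "B ^ q = 4 ^ (Suc D * q)" by (simp only: B_def power_mult)
    have up: "D * B ^ q < B ^ Suc q" using DB by (simp add: B_def)
    obtain i j where ij: "i \<in> A" "j \<in> A" "i \<in> {B ^ q..D * B ^ q}" "j \<in> {B ^ q..D * B ^ q}" "s i > 0" "s j < 0"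
      using both[of "Suc D * q"] unfolding Bq by blast
    then consider "i < j" | "j < i" by (metis less_asym linorder_neqE_nat)
    then show ?thesis
    proof cases
      case 1
      then show ?thesis
        using sign_change_between[of i A j s] ij up by (smt (verit, ccfv_threshold) atLeastAtMost_iff le_less_trans mult_pos_neg order_trans)
    next
      case 2
      then show ?thesis
        using sign_change_between[of j A i s] ij up by (smt (verit, ccfv_threshold) atLeastAtMost_iff le_less_trans mult_neg_pos order_trans)
    qed
  qed
  then have "\<forall>q. \<exists>p. p \<in> sign_changes A s \<and> B ^ q \<le> fst p \<and> snd p < B ^ Suc q"
    by fastforce
  then obtain c where c: "\<And>q. c q \<in> sign_changes A s" "\<And>q. B ^ q \<le> fst (c q)" "\<And>q. snd (c q) < B ^ Suc q"
    by metis
  have lt: "fst (c q) < snd (c q)" for q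
    using c(1)[of q] by (auto simp: sign_changes_def)
  have "B \<ge> 1" by (simp add: B_def)
  have "strict_mono (fst \<circ> c)"
  proof (rule strict_mono_Suc_iff[THEN iffD2], rule allI)
    show "(fst \<circ> c) q < (fst \<circ> c) (Suc q)" for q
      using c(2)[of "Suc q"] c(3)[of q] lt[of q] by simp
  qed
  then have inj: "inj c"
    using strict_mono_imp_inj_on inj_on_imageI2 by blast
  show "infinite (sign_changes A s)"
    using inj c(1) infinite_iff_countable_subset by blast
  have count: "q \<le> sign_change_count A s x" if x: "real (B ^ q) \<le> x" for q x
  proof -
    have fin: "finite {(m, n) \<in> sign_changes A s. real n \<le> x}"
    proof (rule finite_subset)
      show "{(m, n) \<in> sign_changes A s. real n \<le> x} \<subseteq> {..nat \<lfloor>x\<rfloor>} \<times> {..nat \<lfloor>x\<rfloor>}"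
        by (auto simp: sign_changes_def le_nat_floor)
    qed auto
    have "c ` {..<q} \<subseteq> {(m, n) \<in> sign_changes A s. real n \<le> x}"
    proof
      fix y assume "y \<in> c ` {..<q}"
      then obtain i where i: "i < q" "y = c i" by auto
      have "B ^ Suc i \<le> B ^ q" using i \<open>B \<ge> 1\<close> by (intro power_increasing) auto
      then have "snd y \<le> B ^ q" using c(3)[of i] i by simp
      then have "real (snd y) \<le> x" using x by (meson of_nat_le_iff order_trans)
      then show "y \<in> {(m, n) \<in> sign_changes A s. real n \<le> x}"
        using c(1)[of i] i by (cases y) auto
    qed
    then have "card (c ` {..<q}) \<le> sign_change_count A s x"
      unfolding sign_change_count_def using fin by (rule card_mono[rotated])
    then show ?thesis using inj by (simp add: card_image inj_on_subset)
  qed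
  have B4: "real B \<ge> 4" by (simp add: B_def)
  then have lnB: "ln (real B) > 0" by simp
  \<comment> \<open>From \<open>B\<close> squared on, the logarithm \<open>w\<close> is at least 2
    and rounding down loses at most half of it, hence the factor 2 in the constant.\<close>
  have "real (sign_change_count A s x) \<ge> (1 / (2 * ln (real B))) * ln x" if x: "x \<ge> (real B)\<^sup>2" for x
  proof -
    define w where "w = ln x / ln (real B)"
    define q where "q = nat \<lfloor>w\<rfloor>"
    have x1: "x > 0" using x B4 by (smt (verit) zero_less_power)
    have "ln x \<ge> ln ((real B)\<^sup>2)" using x x1 B4 by (subst ln_le_cancel_iff) auto
    then have w: "w \<ge> 2" using lnB B4 by (simp add: w_def ln_realpow field_simps)
    then have q: "real q \<le> w" "real q \<ge> w / 2"
      unfolding q_def by linarith+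
    have "real q * ln (real B) \<le> ln x" using q lnB by (simp add: w_def field_simps)
    then have "ln (real (B ^ q)) \<le> ln x" using B4 by (simp add: ln_realpow)
    then have "real (B ^ q) \<le> x" using x1 B4 by (subst (asm) ln_le_cancel_iff) auto
    then have "real q \<le> real (sign_change_count A s x)" using count by simp
    with q(2) have "w / 2 \<le> real (sign_change_count A s x)" by linarith
    then show ?thesis by (simp add: w_def)
  qed
  moreover have "\<forall>\<^sub>F x in at_top. x \<ge> (real B)\<^sup>2 \<and> x \<ge> 1"
    by (intro eventually_conj eventually_ge_at_top)
  ultimately show "(\<lambda>x::real. real (sign_change_count A s x)) \<in> \<Omega>(\<lambda>x. ln x)"
    by (intro landau_omega.bigI[of "1 / (2 * ln (real B))"])
      (use lnB in \<open>auto elim!: eventually_mono simp: zero_less_mult_iff\<close>)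
qed

subsection \<open>Chains of coefficients\<close>

text \<open>
  The first member \<open>t\<close> of a chain may be divisible by 4: if \<open>t div 4\<close> is not a plus index,
  its coefficient vanishes and \<open>T(4)\<close> gives no relation there.
\<close>

lemma hecke_chain_base:
  fixes \<beta> :: "nat \<Rightarrow> real"
  assumes "\<beta> 0 = 0" "\<beta> n \<noteq> 0"
  shows "\<exists>t j. n = t * 4 ^ j \<and> \<beta> t \<noteq> 0 \<and> (4 dvd t \<longrightarrow> \<beta> (t div 4) = 0)"
  using assms(2)
proof (induction n rule: less_induct)
  case (less n)
  show ?case
  proof (cases "4 dvd n \<and> \<beta> (n div 4) \<noteq> 0")
    case False
    then show ?thesis using less.prems by (intro exI[of _ n] exI[of _ 0]) auto
  next
    case True
    have "n \<noteq> 0" using less.prems assms(1) by metis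
    with True less.IH[of "n div 4"] obtain t j where
      "n div 4 = t * 4 ^ j" "\<beta> t \<noteq> 0" "4 dvd t \<longrightarrow> \<beta> (t div 4) = 0" by auto
    moreover from this(1) True have "n = t * 4 ^ Suc j" by auto
    ultimately show ?thesis by blast
  qed
qed

text \<open>Dividing by powers of \<open>R\<close> turns the last Hecke coefficient into 1. The
  Kronecker symbol vanishes at multiples of 4, so it affects only the first step, as
  \<open>\<delta>\<close>, where \<open>2 ^ (l - 1) \<le> R\<close> bounds it.\<close>

lemma hecke_chain_recurrence:
  fixes \<beta> :: "nat \<Rightarrow> real" and e :: real
  assumes "l \<ge> 1"
    and hecke: "\<And>n. plus_index l n \<Longrightarrow>
      \<beta> (4 * n) + of_int (kronecker_prime ((-1) ^ l * int n) 2) * 2 ^ (l - 1) * \<beta> n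
        + 2 ^ (2 * l - 1) * (if 4 dvd n then \<beta> (n div 4) else 0) = e * \<beta> n"
    and plus: "\<And>n. \<not> plus_index l n \<Longrightarrow> \<beta> n = 0"
    and t: "\<beta> t \<noteq> 0" "4 dvd t \<longrightarrow> \<beta> (t div 4) = 0"
  defines "R \<equiv> sqrt (2 ^ (2 * l - 1))"
  defines "u \<equiv> \<lambda>\<nu>. \<beta> (t * 4 ^ \<nu>) / R ^ \<nu>"
  shows "u (\<nu> + 2) = e / R * u (\<nu> + 1) - u \<nu>"
    and "\<exists>\<delta>. \<bar>\<delta>\<bar> \<le> 1 \<and> u 1 = (e / R - \<delta>) * u 0"
proof -
  have R: "R > 0" "R * R = 2 ^ (2 * l - 1)" by (simp_all add: R_def)
  define m where "m = t * 4 ^ \<nu>"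
  have m: "t * 4 ^ (\<nu> + 1) = 4 * m" "t * 4 ^ (\<nu> + 2) = 4 * (4 * m)"
    by (simp_all add: m_def)
  have "plus_index l (4 * m)"
    by (simp add: plus_index_def mult.left_commute[of "(-1) ^ l" "4 :: int"])
  from hecke[OF this]
  have "\<beta> (4 * (4 * m)) + R * R * \<beta> m = e * \<beta> (4 * m)"
    by (simp add: kronecker_prime_def R)
  then show "u (\<nu> + 2) = e / R * u (\<nu> + 1) - u \<nu>"
    using R(1) unfolding u_def m m_def[symmetric] by (simp add: field_simps)
  define c where "c = real_of_int (kronecker_prime ((-1) ^ l * int t) 2)"
  define \<delta> where "\<delta> = c * 2 ^ (l - 1) / R"
  have "plus_index l t" using plus t by blast
  moreover have "(if 4 dvd t then \<beta> (t div 4) else 0) = 0" using t by simp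
  ultimately have "\<beta> (4 * t) = (e - c * 2 ^ (l - 1)) * \<beta> t"
    using hecke[of t] by (simp add: c_def algebra_simps)
  then have "u 1 = (e / R - \<delta>) * u 0"
    using R(1) by (simp add: u_def \<delta>_def field_simps)
  moreover have "\<bar>\<delta>\<bar> \<le> 1"
  proof -
    have "2 ^ (l - 1) \<le> R"
      unfolding R_def by (intro real_le_rsqrt) (auto simp flip: power_mult intro!: power_increasing)
    moreover have "\<bar>c\<bar> \<le> 1" by (simp add: c_def kronecker_prime_def)
    ultimately have "\<bar>c\<bar> * 2 ^ (l - 1) \<le> 1 * R" using R(1) by (intro mult_mono) auto
    then show ?thesis using R(1) by (simp add: \<delta>_def abs_mult)
  qed
  ultimately show "\<exists>\<delta>. \<bar>\<delta>\<bar> \<le> 1 \<and> u 1 = (e / R - \<delta>) * u 0" by blast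
qed

text \<open>All chains share the parameter \<open>e / R\<close>, so comparing it with 2 settles them
  together: below 2 any one chain oscillates, otherwise each keeps the sign of its base.\<close>

lemma hecke_chain_dichotomy:
  fixes \<beta> :: "nat \<Rightarrow> real" and e :: real
  assumes "l \<ge> 1"
    and hecke: "\<And>n. plus_index l n \<Longrightarrow>
      \<beta> (4 * n) + of_int (kronecker_prime ((-1) ^ l * int n) 2) * 2 ^ (l - 1) * \<beta> n
        + 2 ^ (2 * l - 1) * (if 4 dvd n then \<beta> (n div 4) else 0) = e * \<beta> n"
    and plus: "\<And>n. \<not> plus_index l n \<Longrightarrow> \<beta> n = 0"
    and zero: "\<beta> 0 = 0" and nz: "\<exists>n. \<beta> n \<noteq> 0"
  shows "(\<forall>n \<nu>. \<beta> n \<noteq> 0 \<longrightarrow> \<beta> n * \<beta> (n * 4 ^ \<nu>) > 0) \<or>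
    (\<exists>t K. t > 0 \<and> (\<forall>\<nu>. \<exists>i\<in>{\<nu>..\<nu> + K}. \<exists>j\<in>{\<nu>..\<nu> + K}. \<beta> (t * 4 ^ i) > 0 \<and> \<beta> (t * 4 ^ j) < 0))"
proof -
  define R where "R = sqrt (2 ^ (2 * l - 1))"
  have R: "R > 0" by (simp add: R_def)
  define u where "u = (\<lambda>t \<nu>. \<beta> (t * 4 ^ \<nu>) / R ^ \<nu>)"
  have rec: "u t (\<nu> + 2) = e / R * u t (\<nu> + 1) - u t \<nu>"
      "\<exists>\<delta>. \<bar>\<delta>\<bar> \<le> 1 \<and> u t 1 = (e / R - \<delta>) * u t 0"
    if "\<beta> t \<noteq> 0" "4 dvd t \<longrightarrow> \<beta> (t div 4) = 0" for t \<nu>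
    unfolding u_def R_def
    by (rule hecke_chain_recurrence[where l = l and \<beta> = \<beta>], fact assms(1), erule hecke, erule plus, fact+)+
  show ?thesis
  proof (cases "e / R < 2")
    case True
    obtain n where "\<beta> n \<noteq> 0" using nz by blast
    then obtain t where t: "\<beta> t \<noteq> 0" "4 dvd t \<longrightarrow> \<beta> (t div 4) = 0"
      using hecke_chain_base[of \<beta>, OF zero] by blast
    obtain \<delta> where "\<bar>\<delta>\<bar> \<le> 1" "u t 1 = (e / R - \<delta>) * u t 0"
      using rec(2)[OF t] by blast
    moreover have "u t (\<nu> + 2) = e / R * u t (\<nu> + 1) - u t \<nu>" for \<nu>
      by (rule rec(1)[OF t])
    moreover have "u t 0 \<noteq> 0" using t by (simp add: u_def)
    ultimately obtain K where
      "\<And>\<nu>. \<exists>i\<in>{\<nu>..\<nu> + K}. \<exists>j\<in>{\<nu>..\<nu> + K}. u t i > 0 \<and> u t j < 0"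
      using recurrence_both_signs[of "u t" "e / R" \<delta>] True by blast
    then have "\<forall>\<nu>. \<exists>i\<in>{\<nu>..\<nu> + K}. \<exists>j\<in>{\<nu>..\<nu> + K}. \<beta> (t * 4 ^ i) > 0 \<and> \<beta> (t * 4 ^ j) < 0"
      using R by (simp add: u_def zero_less_divide_iff divide_less_0_iff not_less[symmetric])
    moreover have "t > 0" using t zero by (metis gr0I)
    ultimately show ?thesis by blast
  next
    case False
    have "\<beta> n * \<beta> (n * 4 ^ \<nu>) > 0" if "\<beta> n \<noteq> 0" for n \<nu>
    proof -
      obtain t j where n: "n = t * 4 ^ j" and t: "\<beta> t \<noteq> 0" "4 dvd t \<longrightarrow> \<beta> (t div 4) = 0"
        using hecke_chain_base[of \<beta>, OF zero \<open>\<beta> n \<noteq> 0\<close>] by blast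
      obtain \<delta> where \<delta>: "\<bar>\<delta>\<bar> \<le> 1" "u t 1 = (e / R - \<delta>) * u t 0"
        using rec(2)[OF t] by blast
      have pos: "sgn (\<beta> t) * u t i > 0" for i
      proof (rule recurrence_same_sign)
        show "sgn (\<beta> t) * u t (i + 2) = e / R * (sgn (\<beta> t) * u t (i + 1)) - sgn (\<beta> t) * u t i" for i
          unfolding rec(1)[OF t, of i] by (simp add: algebra_simps)
        show "sgn (\<beta> t) * u t 1 = (e / R - \<delta>) * (sgn (\<beta> t) * u t 0)"
          unfolding \<delta>(2) by simp
        show "sgn (\<beta> t) * u t 0 > 0" using t by (simp add: u_def sgn_if)
      qed (use \<delta>(1) False in auto)
      have "sgn (\<beta> t) * \<beta> (t * 4 ^ i) > 0" for i
        using pos[of i] R by (simp add: u_def zero_less_divide_iff)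
      from mult_pos_pos[OF this[of j] this[of "j + \<nu>"]]
      have "(sgn (\<beta> t) * sgn (\<beta> t)) * (\<beta> n * \<beta> (n * 4 ^ \<nu>)) > 0"
        by (simp only: n power_add mult_ac)
      moreover have "sgn (\<beta> t) * sgn (\<beta> t) = 1" using t by (simp add: sgn_if)
      ultimately show ?thesis by simp
    qed
    then show ?thesis by blast
  qed
qed

section \<open>From chains to almost primes\<close>

lemma times_power_4_in_almost_primes:
  assumes "t > 0" "card (prime_factors t) < r"
  shows "t * 4 ^ i \<in> almost_primes r"
proof -
  \<comment> \<open>A power of 4 can add only the prime 2; the strict inequality for
    \<open>r\<close> leaves room for it.\<close>
  have "prime_factors (t * 4 ^ i) \<subseteq> insert 2 (prime_factors t)"
  proof
    fix p assume "p \<in> prime_factors (t * 4 ^ i)"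
    then have p: "prime p" "p dvd t * 2 ^ (2 * i)"
      by (auto simp: power_mult in_prime_factors_iff)
    then have "p dvd t \<or> p dvd 2"
      using prime_dvd_mult_iff prime_dvd_power by blast
    then show "p \<in> insert 2 (prime_factors t)"
      using p assms(1) by (auto simp: in_prime_factors_iff primes_dvd_imp_eq)
  qed
  then have "card (prime_factors (t * 4 ^ i)) \<le> card (insert 2 (prime_factors t))"
    by (rule card_mono[rotated]) simp
  also have "\<dots> \<le> Suc (card (prime_factors t))"
    by (simp add: card_insert_if)
  finally show ?thesis using assms by (simp add: almost_primes_def)
qed

theorem theorem1p1:
  fixes l :: nat and k :: real and f :: "complex \<Rightarrow> complex" and a :: "nat \<Rightarrow> complex"
  assumes "l \<ge> 2"
    and "k = real l + 1 / 2"
    and "kohnen_plus_eigenform l f"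
    and expansion: "\<And>z. z \<in> upper_half_plane \<Longrightarrow>
          (\<lambda>n. a (Suc n) * of_real (real (Suc n) powr ((k - 1) / 2)) *
               exp (2 * of_real pi * \<i> * of_nat (Suc n) * z)) sums f z"
    and real_coeffs: "\<And>n. n \<ge> 1 \<Longrightarrow> a n \<in> \<real>"
    and ramanujan: "\<And>\<epsilon>::real. \<epsilon> > 0 \<Longrightarrow> \<exists>C::real. \<forall>n\<ge>1. norm (a n) \<le> C * real n powr \<epsilon>"
  shows "\<exists>r\<ge>1. infinite (sign_changes (almost_primes r) (\<lambda>n. Re (a n))) \<and>
           (\<lambda>x::real. real (sign_change_count (almost_primes r) (\<lambda>n. Re (a n)) x)) \<in> \<Omega>(\<lambda>x. ln x)"
proof -
  \<comment> \<open>The expansion does not determine \<open>a 0\<close>; the value 0 lets the series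
    start at index 0. For positive \<open>n\<close> the weight preserves the sign.\<close>
  define \<beta> where "\<beta> = (\<lambda>n. if n = 0 then 0 else Re (a n) * real n powr ((k - 1) / 2))"
  define b where "b = (\<lambda>n. complex_of_real (\<beta> n))"
  have zero: "\<beta> 0 = 0" by (simp add: \<beta>_def)
  have pos: "\<beta> n > 0 \<longleftrightarrow> Re (a n) > 0" and neg: "\<beta> n < 0 \<longleftrightarrow> Re (a n) < 0" if "n > 0" for n
    using that by (simp_all add: \<beta>_def zero_less_mult_iff mult_less_0_iff)
  have q: "(\<lambda>n. b n * exp (2 * of_real pi * \<i> * of_nat n * z)) sums f z"
    if "z \<in> upper_half_plane" for z
  proof -
    have "b (Suc n) = a (Suc n) * of_real (real (Suc n) powr ((k - 1) / 2))" for n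
      using real_coeffs[of "Suc n"] by (simp add: b_def \<beta>_def)
    then show ?thesis
      using expansion[OF that] zero
        sums_Suc_iff[of "\<lambda>n. b n * exp (2 * of_real pi * \<i> * of_nat n * z)" "f z"]
      by (simp add: b_def)
  qed
  have form: "kohnen_plus_cusp_form l f" and "\<exists>z\<in>upper_half_plane. f z \<noteq> 0"
    and "\<exists>ev. \<forall>z\<in>upper_half_plane. hecke l 2 f z = ev * f z"
    using assms(3) two_is_prime_nat unfolding kohnen_plus_eigenform_def by blast+
  then obtain z ev where z: "z \<in> upper_half_plane" "f z \<noteq> 0"
    and ev: "\<And>z. z \<in> upper_half_plane \<Longrightarrow> hecke l 2 f z = ev * f z" by blast
  have nz: "\<exists>n. \<beta> n \<noteq> 0"
  proof (rule ccontr)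
    assume "\<not> ?thesis"
    then have "(\<lambda>n. 0) sums f z" using q[OF z(1)] by (simp add: b_def)
    then show False using z(2) sums_unique2 sums_zero by blast
  qed
  have plus: "\<beta> n = 0" if "\<not> plus_index l n" for n
    using form that fourier_coeff_q_series[OF q, of n]
    by (auto simp: kohnen_plus_cusp_form_def b_def)
  have trans: "f (moebius 1 0 4 1 z) = theta_factor 1 0 4 1 z ^ (2 * l + 1) * f z"
    if "z \<in> upper_half_plane" for z
  proof -
    have "(1::int) * 1 - 0 * 4 = 1 \<and> (4::int) dvd 4" by simp
    then show ?thesis
      using form that unfolding kohnen_plus_cusp_form_def half_integral_cusp_form_def by blast
  qed
  have hecke: "\<beta> (4 * n) + of_int (kronecker_prime ((-1) ^ l * int n) 2) * 2 ^ (l - 1) * \<beta> n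
      + 2 ^ (2 * l - 1) * (if 4 dvd n then \<beta> (n div 4) else 0) = Re ev * \<beta> n"
    if "plus_index l n" for n
  proof -
    have "hecke_coeff l 2 b n = of_real (\<beta> (4 * n)
        + of_int (kronecker_prime ((-1) ^ l * int n) 2) * 2 ^ (l - 1) * \<beta> n
        + 2 ^ (2 * l - 1) * (if 4 dvd n then \<beta> (n div 4) else 0))"
      using that by (simp add: hecke_coeff_def b_def)
    then have "of_real (\<beta> (4 * n)
        + of_int (kronecker_prime ((-1) ^ l * int n) 2) * 2 ^ (l - 1) * \<beta> n
        + 2 ^ (2 * l - 1) * (if 4 dvd n then \<beta> (n div 4) else 0)) = ev * of_real (\<beta> n)"
      using hecke_coeff_2_eigen[OF q ev, of n] by (simp add: b_def)
    \<comment> \<open>Real parts suffice because \<open>\<beta> n\<close> is real, so the eigenvalue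
      need not be shown real.\<close>
    from arg_cong[where f = Re, OF this] show ?thesis
      by (simp only: Re_complex_of_real times_complex.sel Im_complex_of_real mult_zero_right diff_zero)
  qed
  have "l \<ge> 1" using assms(1) by simp
  have "(\<forall>n \<nu>. \<beta> n \<noteq> 0 \<longrightarrow> \<beta> n * \<beta> (n * 4 ^ \<nu>) > 0) \<or>
    (\<exists>t K. t > 0 \<and> (\<forall>\<nu>. \<exists>i\<in>{\<nu>..\<nu> + K}. \<exists>j\<in>{\<nu>..\<nu> + K}. \<beta> (t * 4 ^ i) > 0 \<and> \<beta> (t * 4 ^ j) < 0))"
    by (rule hecke_chain_dichotomy[where l = l]) (fact \<open>l \<ge> 1\<close> zero nz | erule hecke plus)+
  then have "\<exists>r\<ge>1. \<exists>D\<ge>1. \<forall>v. \<exists>i\<in>almost_primes r. \<exists>j\<in>almost_primes r.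
      i \<in> {4 ^ v..D * 4 ^ v} \<and> j \<in> {4 ^ v..D * 4 ^ v} \<and> Re (a i) > 0 \<and> Re (a j) < 0"
  proof (elim disjE exE conjE)
    assume same: "\<forall>n \<nu>. \<beta> n \<noteq> 0 \<longrightarrow> \<beta> n * \<beta> (n * 4 ^ \<nu>) > 0"
    have "\<exists>n. \<beta> n < 0"
    proof (rule ccontr)
      assume "\<not> ?thesis"
      then have "\<beta> n \<ge> 0" for n by (simp add: not_less)
      moreover from this have "\<beta> n \<le> 0" for n
        using plus_form_coeff_nonpos[of \<beta>, OF q[unfolded b_def] zero trans plus] by blast
      ultimately show False using nz by (metis order_antisym)
    qed
    then obtain n2 where n2: "\<beta> n2 < 0" by blast
    \<comment> \<open>The same cusp argument, applied to \<open>- f\<close>.\<close>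
    have "\<exists>n. \<beta> n > 0"
    proof (rule ccontr)
      assume "\<not> ?thesis"
      then have "- \<beta> n \<ge> 0" for n by (simp add: not_less)
      moreover have "(\<lambda>n. of_real (- \<beta> n) * exp (2 * of_real pi * \<i> * of_nat n * z)) sums (- f z)"
        if "z \<in> upper_half_plane" for z
        using sums_minus[OF q[OF that]] by (simp add: b_def)
      ultimately have "- \<beta> n2 \<le> 0"
        using plus_form_coeff_nonpos[of "\<lambda>n. - \<beta> n" "\<lambda>z. - f z" "2 * l + 1" l n2] zero trans plus
        by simp
      then show False using n2 by simp
    qed
    then obtain n1 where n1: "\<beta> n1 > 0" by blast
    have n: "n1 > 0" "n2 > 0" using n1 n2 zero by (metis gr0I less_irrefl)+
    \<comment> \<open>One bound for both chains; likewise \<open>n1 + n2\<close> serves as a common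
      \<open>D\<close>.\<close>
    define r where "r = card (prime_factors n1) + card (prime_factors n2) + 1"
    have "\<exists>i\<in>almost_primes r. \<exists>j\<in>almost_primes r. i \<in> {4 ^ v..(n1 + n2) * 4 ^ v}
        \<and> j \<in> {4 ^ v..(n1 + n2) * 4 ^ v} \<and> Re (a i) > 0 \<and> Re (a j) < 0" for v
    proof -
      have "n1 * 4 ^ v \<in> almost_primes r" "n2 * 4 ^ v \<in> almost_primes r"
        using n by (auto intro!: times_power_4_in_almost_primes simp: r_def)
      moreover have "n1 * 4 ^ v \<in> {4 ^ v..(n1 + n2) * 4 ^ v}" "n2 * 4 ^ v \<in> {4 ^ v..(n1 + n2) * 4 ^ v}"
        using n by auto
      moreover have "Re (a (n1 * 4 ^ v)) > 0" "Re (a (n2 * 4 ^ v)) < 0"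
      proof -
        have "\<beta> n1 * \<beta> (n1 * 4 ^ v) > 0" "\<beta> n2 * \<beta> (n2 * 4 ^ v) > 0"
          using same n1 n2 by auto
        then have "\<beta> (n1 * 4 ^ v) > 0" "\<beta> (n2 * 4 ^ v) < 0"
          using n1 n2 by (auto simp: zero_less_mult_iff)
        then show "Re (a (n1 * 4 ^ v)) > 0" "Re (a (n2 * 4 ^ v)) < 0"
          using n by (simp_all add: pos neg)
      qed
      ultimately show ?thesis by blast
    qed
    moreover have "r \<ge> 1" "n1 + n2 \<ge> 1" using n by (auto simp: r_def)
    ultimately show ?thesis by blast
  next
    fix t K
    assume t: "t > 0" and osc: "\<forall>\<nu>. \<exists>i\<in>{\<nu>..\<nu> + K}. \<exists>j\<in>{\<nu>..\<nu> + K}. \<beta> (t * 4 ^ i) > 0 \<and> \<beta> (t * 4 ^ j) < 0"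
    define r where "r = card (prime_factors t) + 1"
    have mem: "t * 4 ^ i \<in> almost_primes r" for i
      using t by (auto intro!: times_power_4_in_almost_primes simp: r_def)
    \<comment> \<open>A window of exponents of length \<open>K\<close> costs a factor
      \<open>4 ^ K\<close>, so \<open>D\<close> is \<open>t * 4 ^ K\<close>.\<close>
    have range: "t * 4 ^ i \<in> {4 ^ v..t * 4 ^ K * 4 ^ v}" if "i \<in> {v..v + K}" for i v
    proof -
      have "1 * 4 ^ v \<le> t * 4 ^ i" "t * 4 ^ i \<le> t * 4 ^ (v + K)"
        using that t by (intro mult_mono power_increasing; simp)+
      then show ?thesis by (simp add: power_add mult_ac)
    qed
    have "\<exists>i\<in>almost_primes r. \<exists>j\<in>almost_primes r. i \<in> {4 ^ v..t * 4 ^ K * 4 ^ v}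
        \<and> j \<in> {4 ^ v..t * 4 ^ K * 4 ^ v} \<and> Re (a i) > 0 \<and> Re (a j) < 0" for v
    proof -
      obtain i j where "i \<in> {v..v + K}" "j \<in> {v..v + K}" "\<beta> (t * 4 ^ i) > 0" "\<beta> (t * 4 ^ j) < 0"
        using osc by blast
      then show ?thesis
        using mem range t by (intro bexI[of _ "t * 4 ^ i"] bexI[of _ "t * 4 ^ j"]) (auto simp: pos neg)
    qed
    moreover have "r \<ge> 1" "t * 4 ^ K \<ge> 1" using t by (auto simp: r_def)
    ultimately show ?thesis by blast
  qed
  then obtain r D where r: "r \<ge> 1" and "D \<ge> 1" and
    "\<And>v. \<exists>i\<in>almost_primes r. \<exists>j\<in>almost_primes r.
      i \<in> {4 ^ v..D * 4 ^ v} \<and> j \<in> {4 ^ v..D * 4 ^ v} \<and> Re (a i) > 0 \<and> Re (a j) < 0"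
    by blast
  from sign_change_count_bigomega_ln[OF this(2,3)] r show ?thesis by blast
qed

end
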